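(* Let $m\ge n\ge 0$ be integers, let $\lambda$ be a partition inside the $n\times m$ board, and let $0\le j\le n$. Then \[ H^{m,n}_j(\lambda)=\sum_p q^{\mathrm{stat}(p)}, \] where the sum is over all placements $p$ of $n$ non-attacking rooks on the $n\times m$ board with exactly $j$ rooks on cells of $\lambda$, and where $\mathrm{stat}(p)$ is the number of cells $c$ of the $n\times m$ board such that: (i) there is no rook in $c$; (ii) there is no rook above $c$ in the same column; and either (iii) $c$ is in $\lambda$ and the rook in the same row as $c$ lies in $\lambda$ and to the right of $c$, or (iv) $c$ is not in $\lambda$ and the rook in the same row as $c$ either lies in $\lambda$ or lies to the right of $c$. (Every row contains exactly one rook.)
   Context: $q$ is an indeterminate. For an integer $x$, $[x]=(1-q^x)/(1-q)$; $[n]_k=[n][n-1]\cdots[n-k+1]$ (with $[n]_0=1$), $[n]!=[n]_n$, $\binom{n}{k}_q=[n]_k/[k]!$, and $(a;q)_k=\prod_{i=0}^{k-1}(1-aq^i)$. A partition $\lambda=(\lambda_1\ge\cdots\ge\lambda_\ell>0)$ is identified with its Ferrers board, the set of cells $(i,j)$ with $1\le i\le \ell$, $1\le j\le\lambda_i$, where rows are numbered from the top and columns from the left; $|\lambda|$ is its number of cells. The $n\times m$ board has $n$ rows and $m$ columns, and $\lambda$ is inside it if $\ell\le n$ and $\lambda_1\le m$. The Garsia–Remmel $q$-rook number $R_k(\lambda)=\sum_p q^{\mathrm{inv}(p)}$, summed over placements $p$ of $k$ non-attacking rooks (no two in a row or column) on cells of $\lambda$, where $\mathrm{inv}(p)$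 is the number of cells of $\lambda$ that contain no rook, are not to the left of a rook in the same row, and are not above a rook in the same column. For $m\ge n$ and $\lambda$ inside the $n\times m$ board, the $q$-hit numbers $H^{m,n}_i(\lambda)$, $0\le i\le n$, are defined by the polynomial identity in $x$: \[ \sum_{i=0}^n H^{m,n}_i(\lambda)x^i=\frac{q^{-|\lambda|}}{[m-n]!}\sum_{i=0}^n R_i(\lambda)\,[m-i]!\,(-1)^i q^{mi-\binom{i}{2}}(x;q)_i . \] *)

theory Defs
  imports "HOL-Computational_Algebra.Polynomial" "HOL-Computational_Algebra.Fraction_Field"
begin

text \<open>
  All \<open>q\<close>-quantities live in the field of rational functions over the rationals in the
  indeterminate \<open>q\<close>; polynomials in the second indeterminate \<open>x\<close> are univariate polynomials
  over that field.
\<close>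

type_synonym qfield = "rat poly fract"

definition q :: qfield where
  "q = Fract [:0, 1:] 1"

definition qint :: "int \<Rightarrow> qfield" where
  "qint x = (1 - q powi x) / (1 - q)"

definition qfalling :: "int \<Rightarrow> nat \<Rightarrow> qfield" where
  "qfalling n k = (\<Prod>i<k. qint (n - int i))"

definition qfact :: "nat \<Rightarrow> qfield" where
  "qfact n = qfalling (int n) n"

definition qpochhammer :: "'a :: comm_ring_1 \<Rightarrow> 'a \<Rightarrow> nat \<Rightarrow> 'a" where
  "qpochhammer a b k = (\<Prod>i<k. 1 - a * b ^ i)"

type_synonym cell = "nat \<times> nat"

text \<open>Cells are pairs (row, column), both counted from 1; row 1 is the top row.\<close>

definition is_partition :: "nat list \<Rightarrow> bool" where
  "is_partition la \<longleftrightarrow> sorted_wrt (\<ge>) la \<and> (\<forall>a\<in>set la. a > 0)"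

definition ferrers :: "nat list \<Rightarrow> cell set" where
  "ferrers la = {(i, j). 1 \<le> i \<and> i \<le> length la \<and> 1 \<le> j \<and> j \<le> la ! (i - 1)}"

definition board :: "nat \<Rightarrow> nat \<Rightarrow> cell set" where
  "board n m = {1..n} \<times> {1..m}"

definition inside_board :: "nat list \<Rightarrow> nat \<Rightarrow> nat \<Rightarrow> bool" where
  "inside_board la n m \<longleftrightarrow> length la \<le> n \<and> (la \<noteq> [] \<longrightarrow> hd la \<le> m)"

definition nonattacking :: "cell set \<Rightarrow> bool" where
  "nonattacking p \<longleftrightarrow>
     (\<forall>c\<in>p. \<forall>d\<in>p. c \<noteq> d \<longrightarrow> fst c \<noteq> fst d \<and> snd c \<noteq> snd d)"

definition placements :: "cell set \<Rightarrow> nat \<Rightarrow> cell set set" where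
  "placements B k = {p. p \<subseteq> B \<and> finite p \<and> card p = k \<and> nonattacking p}"

definition inv_stat :: "nat list \<Rightarrow> cell set \<Rightarrow> nat" where
  "inv_stat la p = card {(i, j). (i, j) \<in> ferrers la \<and> (i, j) \<notin> p \<and>
     \<not> (\<exists>j'. (i, j') \<in> p \<and> j < j') \<and>
     \<not> (\<exists>i'. (i', j) \<in> p \<and> i < i')}"

definition qrook :: "nat list \<Rightarrow> nat \<Rightarrow> qfield" where
  "qrook la k = (\<Sum>p\<in>placements (ferrers la) k. q ^ inv_stat la p)"

text \<open>
  The right-hand side of the defining identity of the \<open>q\<close>-hit numbers, as a polynomial in
  \<open>x = [:0, 1:]\<close>, with \<open>[:q:]\<close> the constant polynomial \<open>q\<close>. It is meant for
  \<open>n \<le> m\<close>, so that the differences \<open>m - n\<close> and \<open>m - i\<close> of natural numbers are not truncated.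
\<close>

definition qhit_poly :: "nat \<Rightarrow> nat \<Rightarrow> nat list \<Rightarrow> qfield poly" where
  "qhit_poly m n la =
     smult (q powi (- int (card (ferrers la))) / qfact (m - n))
       (\<Sum>i\<le>n. smult (qrook la i * qfact (m - i) * (- 1) ^ i
                        * q powi (int m * int i - int (i choose 2)))
                     (qpochhammer [:0, 1:] [:q:] i))"

definition qhit :: "nat \<Rightarrow> nat \<Rightarrow> nat list \<Rightarrow> nat \<Rightarrow> qfield" where
  "qhit m n la i = coeff (qhit_poly m n la) i"

lemma degree_qpochhammer_le:
  "degree (qpochhammer [:0, 1:] [:c:] k :: 'a :: comm_ring_1 poly) \<le> k"
proof (induction k)
  case 0
  then show ?case by (simp add: qpochhammer_def)
next
  case (Suc k)
  have "degree ([:0, 1:] * [:c:] ^ k :: 'a poly) \<le> 1"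
    by (rule order_trans[OF degree_mult_le]) (simp add: poly_const_pow)
  then have "degree (1 - [:0, 1:] * [:c:] ^ k :: 'a poly) \<le> 1"
    by (intro degree_diff_le) auto
  moreover have "qpochhammer [:0, 1:] [:c:] (Suc k) =
      qpochhammer [:0, 1:] [:c:] k * (1 - [:0, 1:] * [:c:] ^ k :: 'a poly)"
    by (simp add: qpochhammer_def)
  ultimately show ?case
    using Suc.IH degree_mult_le[of "qpochhammer [:0, 1:] [:c:] k" "1 - [:0, 1:] * [:c:] ^ k :: 'a poly"]
    by simp
qed

lemma qhit_identity: "(\<Sum>i\<le>n. monom (qhit m n la i) i) = qhit_poly m n la"
proof -
  have "degree (qpochhammer [:0, 1:] [:q:] i) \<le> n" if "i \<le> n" for i
    using degree_qpochhammer_le that by (rule order_trans)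
  then have "degree (qhit_poly m n la) \<le> n"
    unfolding qhit_poly_def
    by (intro order_trans[OF degree_smult_le] degree_sum_le) simp_all
  then show ?thesis
    unfolding qhit_def by (rule poly_as_sum_of_monoms')
qed

definition hit_placements :: "nat \<Rightarrow> nat \<Rightarrow> nat list \<Rightarrow> nat \<Rightarrow> cell set set" where
  "hit_placements m n la k = {p \<in> placements (board n m) n. card (p \<inter> ferrers la) = k}"

definition stat :: "nat \<Rightarrow> nat \<Rightarrow> nat list \<Rightarrow> cell set \<Rightarrow> nat" where
  "stat m n la p = card {(i, j). (i, j) \<in> board n m \<and> (i, j) \<notin> p \<and>
     \<not> (\<exists>i'. (i', j) \<in> p \<and> i' < i) \<and>
     ((i, j) \<in> ferrers la \<and>
        (\<exists>j'. (i, j') \<in> p \<and> (i, j') \<in> ferrers la \<and> j < j') \<or>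
      (i, j) \<notin> ferrers la \<and>
        (\<exists>j'. (i, j') \<in> p \<and> ((i, j') \<in> ferrers la \<or> j < j')))}"

end

theory Submission
  imports Defs
begin

text \<open>
  Remove the top row, of length \<open>l\<close>, of the board. If its rook is in column \<open>r\<close>, what remains is
  a hit problem for the board without that row and column, and the cells counted by the statistic
  in the top row are the columns met when reading cyclically from column \<open>l + 1\<close> until the rook.
  The \<open>q\<close>-rook numbers of the boards with column \<open>r\<close> deleted, weighted by these powers of \<open>q\<close>
  and summed over \<open>r \<le> l\<close>, collapse to a \<open>q\<close>-integer times the \<open>q\<close>-rook numbers of the board
  without its top row. Hence both sides of the claim satisfy the same recursion.
\<close>

section \<open>Arithmetic of \<open>q\<close>-integers and \<open>q\<close>-factorials\<close>

lemma q_neq_0 [simp]: "q \<noteq> 0"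
  by (simp add: q_def Zero_fract_def eq_fract)

lemma q_neq_1 [simp]: "q \<noteq> 1"
  by (simp add: q_def One_fract_def eq_fract one_pCons)

lemma qint_0 [simp]: "qint 0 = 0"
  by (simp add: qint_def)

lemma qint_add: "qint (a + b) = qint a + q powi a * qint b"
  by (simp add: qint_def power_int_add add_divide_distrib[symmetric] algebra_simps)

lemma qint_Suc: "qint (int (Suc n)) = qint (int n) + q ^ n"
proof -
  have "qint 1 = 1"
    by (simp add: qint_def)
  then show ?thesis
    using qint_add[of "int n" 1] by (simp add: add.commute)
qed

lemma qfact_Suc: "qfact (Suc n) = qint (int (Suc n)) * qfact n"
  by (simp add: qfact_def qfalling_def prod.lessThan_Suc_shift del: prod.lessThan_Suc)

lemma q_power_eq_1_iff: "q ^ n = 1 \<longleftrightarrow> n = 0"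
proof -
  have "q ^ n = Fract ([:0, 1:] ^ n) 1"
    by (induction n) (simp_all add: q_def One_fract_def)
  moreover have "degree ([:0, 1:] ^ n :: rat poly) = n"
    by (simp add: degree_power_eq)
  ultimately show ?thesis
    by (auto simp: One_fract_def eq_fract)
qed

text \<open>Since \<open>q\<close> is no root of unity, no factor vanishes. This lets the
  normalising quotient in \<open>hit_formula\<close> cancel when no row is left.\<close>

lemma qfact_neq_0 [simp]: "qfact n \<noteq> 0"
proof (induction n)
  case 0
  then show ?case by (simp add: qfact_def qfalling_def)
next
  case (Suc n)
  then show ?case
    using q_power_eq_1_iff[of "Suc n"] by (simp add: qfact_Suc qint_def del: of_nat_Suc power_Suc)
qed

text \<open>As \<open>r\<close> runs upwards through \<open>A\<close>, the exponents are 0, 1, 2 and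
  so on: the sum is geometric.\<close>

lemma sum_q_power_card_less:
  fixes A :: "nat set"
  assumes "finite A"
  shows "(\<Sum>r\<in>A. q ^ card (A \<inter> {..<r})) = qint (int (card A))"
  using assms
proof (induction A rule: finite_linorder_max_induct)
  case empty
  then show ?case by simp
next
  case (insert b A)
  have "insert b A \<inter> {..<r} = A \<inter> {..<r}" if "r \<in> A" for r
    using that insert by auto
  moreover have "insert b A \<inter> {..<b} = A" "b \<notin> A"
    using insert by auto
  ultimately show ?case
    using insert by (simp add: qint_Suc add.commute del: of_nat_Suc)
qed

lemma sum_q_power_card_greater:
  fixes A :: "nat set"
  assumes "finite A"
  shows "(\<Sum>r\<in>A. q ^ card (A \<inter> {r<..})) = qint (int (card A))"
  using assms
proof (induction A rule: finite_linorder_min_induct)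
  case empty
  then show ?case by simp
next
  case (insert b A)
  have "insert b A \<inter> {r<..} = A \<inter> {r<..}" if "r \<in> A" for r
    using that insert by auto
  moreover have "insert b A \<inter> {b<..} = A" "b \<notin> A"
    using insert by auto
  ultimately show ?case
    using insert by (simp add: qint_Suc add.commute del: of_nat_Suc)
qed

section \<open>A recursive form of the \<open>q\<close>-rook numbers and the effect of deleting a
  column\<close>

text \<open>
  To avoid renumbering when rows and columns are deleted, the boards have the rows
  \<open>s + 1, \<dots>, s + d\<close> and the columns in \<open>C\<close>; row \<open>i\<close> of the Ferrers board consists of the columns
  of \<open>C\<close> that are at most \<open>lam i\<close>.
\<close>

primrec board_size :: "(nat \<Rightarrow> nat) \<Rightarrow> nat \<Rightarrow> nat \<Rightarrow> nat set \<Rightarrow> nat" where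
  "board_size lam 0 s C = 0"
| "board_size lam (Suc d) s C = card (C \<inter> {..lam (Suc s)}) + board_size lam d (Suc s) C"

text \<open>These are the Garsia-Remmel \<open>q\<close>-rook numbers, split by the top row, of
  \<open>a\<close> cells say. If the row lengths weakly decrease, \<open>k\<close> rooks below block
  \<open>k\<close> of these cells. Without a rook in the top row, the other \<open>a - k\<close>
  cells all count; a rook added above \<open>k'\<close> others has \<open>a - k'\<close> columns to
  choose from, with exponents 0 up to \<open>a - k' - 1\<close>. \<open>rook_rec_eq_sum\<close>
  makes this precise.\<close>

primrec rook_rec :: "(nat \<Rightarrow> nat) \<Rightarrow> nat \<Rightarrow> nat \<Rightarrow> nat set \<Rightarrow> nat \<Rightarrow> qfield" where
  "rook_rec lam 0 s C k = (if k = 0 then 1 else 0)"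
| "rook_rec lam (Suc d) s C k =
     q powi (int (card (C \<inter> {..lam (Suc s)})) - int k) * rook_rec lam d (Suc s) C k +
     (case k of 0 \<Rightarrow> 0 | Suc k' \<Rightarrow>
        qint (int (card (C \<inter> {..lam (Suc s)})) - int k') * rook_rec lam d (Suc s) C k')"

lemma rook_rec_eq_0: "d < k \<Longrightarrow> rook_rec lam d s C k = 0"
  by (induction d arbitrary: s k) (auto split: nat.split)

lemma Diff_column_Int_atMost:
  fixes r l :: nat
  shows "l < r \<Longrightarrow> (C - {r}) \<inter> {..l} = C \<inter> {..l}"
  by auto

text \<open>Row \<open>Suc s\<close> is the longest one left, so no row reaches column
  \<open>r\<close>.\<close>

lemma remove_outer_column:
  assumes "antimono lam" "lam (Suc s) < r"
  shows "board_size lam d s (C - {r}) = board_size lam d s C"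
    and "rook_rec lam d s (C - {r}) k = rook_rec lam d s C k"
proof -
  have "board_size lam d s (C - {r}) = board_size lam d s C \<and>
    rook_rec lam d s (C - {r}) k = rook_rec lam d s C k" for k
    using assms(2)
  proof (induction d arbitrary: s k)
    case (Suc d)
    have "lam (Suc (Suc s)) < r"
      using antimonoD[OF assms(1), of "Suc s" "Suc (Suc s)"] Suc.prems by simp
    then show ?case
      using Suc by (simp add: Diff_column_Int_atMost split: nat.split)
  qed simp
  then show "board_size lam d s (C - {r}) = board_size lam d s C"
    and "rook_rec lam d s (C - {r}) k = rook_rec lam d s C k"
    by blast+
qed

lemma sum_q_power_card_less_atMost:
  fixes C :: "nat set"
  assumes "finite C"
  shows "(\<Sum>r\<in>C \<inter> {..l}. q ^ card (C \<inter> {..<r})) = qint (int (card (C \<inter> {..l})))"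
proof -
  have "C \<inter> {..<r} = (C \<inter> {..l}) \<inter> {..<r}" if "r \<le> l" for r
    using that by auto
  then have "(\<Sum>r\<in>C \<inter> {..l}. q ^ card (C \<inter> {..<r})) =
    (\<Sum>r\<in>C \<inter> {..l}. q ^ card ((C \<inter> {..l}) \<inter> {..<r}))"
    by (intro sum.cong) auto
  then show ?thesis
    using sum_q_power_card_less assms by simp
qed

text \<open>
  In terms of placements: if \<open>k\<close> rooks avoid column \<open>r\<close>, then deleting \<open>r\<close> changes the exponent by
  the number of cells of column \<open>r\<close> not left of a rook, which leaves \<open>k\<close> plus the number of
  rook-free columns before \<open>r\<close>.
\<close>

lemma rook_rec_remove_column_sum:
  assumes "antimono lam" "finite C" "lam (Suc s) \<le> L"
  shows "(\<Sum>r\<in>C \<inter> {..L}. q powi (int (card (C \<inter> {..<r})) - int (board_size lam d s (C - {r})))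
             * rook_rec lam d s (C - {r}) k)
    = q powi (int k - int (board_size lam d s C)) * qint (int (card (C \<inter> {..L})) - int k)
        * rook_rec lam d s C k"
  using assms(3)
\<comment> \<open>\<open>L\<close> stays arbitrary because the induction hypothesis is needed with
  \<open>L\<close> replaced by the length \<open>l\<close> of the row split off.\<close>
proof (induction d arbitrary: s L k)
  case 0
  then show ?case
    using sum_q_power_card_less_atMost[OF assms(2), of L] by simp
next
  case (Suc d)
  define l where "l = lam (Suc s)"
  define a where "a = int (card (C \<inter> {..l}))"
  define b where "b = int (board_size lam d (Suc s) C)"
  define R where "R = rook_rec lam d (Suc s) C"
  define S where "S = rook_rec lam (Suc d) s C k"
  define aL where "aL = int (card (C \<inter> {..L}))"
  have l: "lam (Suc (Suc s)) \<le> l"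
    unfolding l_def using assms(1) by (simp add: antimonoD)
  have IH: "(\<Sum>r\<in>C \<inter> {..l}. q powi (int (card (C \<inter> {..<r})) - int (board_size lam d (Suc s) (C - {r})))
             * rook_rec lam d (Suc s) (C - {r}) k)
    = q powi (int k - b) * qint (a - int k) * R k" for k
    using Suc.IH[OF l] by (simp add: a_def b_def R_def)
  define w where "w r = q powi (int (card (C \<inter> {..<r})) - int (board_size lam d (Suc s) (C - {r})))" for r
  have card_r: "int (card ((C - {r}) \<inter> {..l})) = a - 1" if "r \<in> C \<inter> {..l}" for r
  proof -
    have "(C - {r}) \<inter> {..l} = (C \<inter> {..l}) - {r}" by auto
    moreover have "card (C \<inter> {..l}) > 0"
      using that assms(2) by (auto simp: card_gt_0_iff)
    ultimately show ?thesis
      using that assms(2) by (simp add: a_def)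
  qed
  have inner: "(\<Sum>r\<in>C \<inter> {..l}. q powi (int (card (C \<inter> {..<r})) - int (board_size lam (Suc d) s (C - {r})))
             * rook_rec lam (Suc d) s (C - {r}) k) = q powi (int k - a - b) * qint (a - int k) * S"
  proof (cases k)
    case 0
    have "(\<Sum>r\<in>C \<inter> {..l}. q powi (int (card (C \<inter> {..<r})) - int (board_size lam (Suc d) s (C - {r})))
             * rook_rec lam (Suc d) s (C - {r}) k) =
          (\<Sum>r\<in>C \<inter> {..l}. w r * rook_rec lam d (Suc s) (C - {r}) 0)"
    proof (rule sum.cong[OF refl])
      fix r assume r: "r \<in> C \<inter> {..l}"
      show "q powi (int (card (C \<inter> {..<r})) - int (board_size lam (Suc d) s (C - {r})))
             * rook_rec lam (Suc d) s (C - {r}) k = w r * rook_rec lam d (Suc s) (C - {r}) 0"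
        using card_r[OF r] 0
        by (simp add: w_def l_def[symmetric] power_int_diff power_int_add field_simps)
    qed
    also have "\<dots> = q powi (int k - a - b) * qint (a - int k) * S"
      using IH[of 0] 0
      by (simp add: w_def S_def l_def[symmetric] a_def[symmetric] R_def[symmetric] power_int_diff power_int_minus field_simps)
    finally show ?thesis .
  next
    case (Suc k')
    \<comment> \<open>Without column \<open>r\<close> the top row has \<open>a - 1\<close> cells,
      and \<open>qint (a - 1 - k') = qint (a - k)\<close>. The induction hypothesis gives the same
      factor for the term with \<open>k\<close> rooks below, so it comes out of both terms and the
      rest recombines to \<open>S\<close>.\<close>
    have "(\<Sum>r\<in>C \<inter> {..l}. q powi (int (card (C \<inter> {..<r})) - int (board_size lam (Suc d) s (C - {r})))
             * rook_rec lam (Suc d) s (C - {r}) k) =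
          (\<Sum>r\<in>C \<inter> {..l}. q powi (- int k) * (w r * rook_rec lam d (Suc s) (C - {r}) k)
            + q powi (1 - a) * qint (a - int k) * (w r * rook_rec lam d (Suc s) (C - {r}) k'))"
    proof (rule sum.cong[OF refl])
      fix r assume r: "r \<in> C \<inter> {..l}"
      show "q powi (int (card (C \<inter> {..<r})) - int (board_size lam (Suc d) s (C - {r})))
             * rook_rec lam (Suc d) s (C - {r}) k =
         q powi (- int k) * (w r * rook_rec lam d (Suc s) (C - {r}) k)
            + q powi (1 - a) * qint (a - int k) * (w r * rook_rec lam d (Suc s) (C - {r}) k')"
        unfolding board_size.simps rook_rec.simps l_def[symmetric] of_nat_add card_r[OF r] w_def
        using Suc
        by (simp add: algebra_simps power_int_diff power_int_add power_int_minus field_simps power2_eq_square)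
    qed
    also have "\<dots> = q powi (- int k) * (q powi (int k - b) * qint (a - int k) * R k)
        + q powi (1 - a) * qint (a - int k) * (q powi (int k' - b) * qint (a - int k') * R k')"
      by (simp only: sum.distrib sum_distrib_left[symmetric] w_def IH)
    also have "\<dots> = q powi (int k - a - b) * qint (a - int k) * S"
      using Suc
      by (simp add: S_def l_def[symmetric] a_def[symmetric] R_def[symmetric] power_int_diff power_int_add
          power_int_minus field_simps)
    finally show ?thesis .
  qed
  have "(\<Sum>r\<in>C \<inter> {..L}. q ^ card (C \<inter> {..<r})) =
      (\<Sum>r\<in>C \<inter> {..l}. q ^ card (C \<inter> {..<r})) + (\<Sum>r\<in>C \<inter> {l<..L}. q ^ card (C \<inter> {..<r}))"
    using assms(2) Suc.prems
    by (subst sum.union_disjoint[symmetric]) (auto intro!: sum.cong simp: l_def)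
  then have geom: "(\<Sum>r\<in>C \<inter> {l<..L}. q ^ card (C \<inter> {..<r})) = q powi a * qint (aL - a)"
    using sum_q_power_card_less_atMost[OF assms(2)] qint_add[of a "aL - a"]
    by (simp add: a_def aL_def)
  \<comment> \<open>Columns beyond \<open>l\<close> meet none of the rows, so only the power of
    \<open>q\<close> in front depends on \<open>r\<close>.\<close>
  have "(\<Sum>r\<in>C \<inter> {l<..L}. q powi (int (card (C \<inter> {..<r})) - int (board_size lam (Suc d) s (C - {r})))
             * rook_rec lam (Suc d) s (C - {r}) k)
    = (\<Sum>r\<in>C \<inter> {l<..L}. q ^ card (C \<inter> {..<r})) * (q powi (- a - b) * S)"
    unfolding sum_distrib_right
  proof (rule sum.cong[OF refl])
    fix r assume "r \<in> C \<inter> {l<..L}"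
    then have "lam (Suc s) < r" by (simp add: l_def)
    note * = remove_outer_column[OF assms(1) this, of "Suc d" C]
    show "q powi (int (card (C \<inter> {..<r})) - int (board_size lam (Suc d) s (C - {r})))
             * rook_rec lam (Suc d) s (C - {r}) k = q ^ card (C \<inter> {..<r}) * (q powi (- a - b) * S)"
      unfolding * S_def
      by (simp add: power_int_diff power_int_add power_int_minus a_def b_def l_def field_simps)
  qed
  then have outer: "(\<Sum>r\<in>C \<inter> {l<..L}. q powi (int (card (C \<inter> {..<r})) - int (board_size lam (Suc d) s (C - {r})))
             * rook_rec lam (Suc d) s (C - {r}) k) = q powi (- b) * qint (aL - a) * S"
    unfolding geom by (simp add: power_int_diff power_int_minus field_simps)
  have "(\<Sum>r\<in>C \<inter> {..L}. q powi (int (card (C \<inter> {..<r})) - int (board_size lam (Suc d) s (C - {r})))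
             * rook_rec lam (Suc d) s (C - {r}) k) =
      q powi (int k - a - b) * qint (a - int k) * S + q powi (- b) * qint (aL - a) * S"
    unfolding inner[symmetric] outer[symmetric]
    using assms(2) Suc.prems
    by (subst sum.union_disjoint[symmetric]) (auto intro!: sum.cong simp: l_def)
  \<comment> \<open>The two intervals of columns join: \<open>qint (a - k)\<close> and
    \<open>q powi (a - k) * qint (aL - a)\<close> add up to \<open>qint (aL - k)\<close>.\<close>
  also have "\<dots> = q powi (int k - a - b) * qint (aL - int k) * S"
    using qint_add[of "a - int k" "aL - a"] by (simp add: power_int_diff power_int_add power_int_minus field_simps)
  finally show ?case
    by (simp add: aL_def a_def b_def S_def l_def algebra_simps)
qed


section \<open>The top-row recursion for the defining polynomial of the \<open>q\<close>-hit
  numbers\<close>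

lemma smult_sum_right: "smult c (sum f A) = (\<Sum>x\<in>A. smult c (f x))"
  by (induction A rule: infinite_finite_induct) (simp_all add: smult_add_right)

text \<open>This is \<open>qhit_poly\<close> with \<open>card C\<close> in the role of
  \<open>m\<close> and \<open>d\<close> in the role of \<open>n\<close>.\<close>

definition hit_formula :: "(nat \<Rightarrow> nat) \<Rightarrow> nat \<Rightarrow> nat \<Rightarrow> nat set \<Rightarrow> qfield poly" where
  "hit_formula lam d s C =
     smult (q powi (- int (board_size lam d s C)) / qfact (card C - d))
       (\<Sum>i\<le>d. smult (rook_rec lam d s C i * qfact (card C - i) * (- 1) ^ i
                        * q powi (int (card C) * int i - int (i choose 2)))
                     (qpochhammer [:0, 1:] [:q:] i))"

text \<open>The number of columns of \<open>C\<close> met when reading cyclically from just after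
  \<open>lam t\<close>, before the rook in column \<open>r\<close> is reached.\<close>

definition row_stat :: "(nat \<Rightarrow> nat) \<Rightarrow> nat \<Rightarrow> nat set \<Rightarrow> nat \<Rightarrow> nat" where
  "row_stat lam t C r = (if r \<le> lam t then card (C \<inter> {..<r}) + card (C \<inter> {lam t<..})
     else card (C \<inter> {lam t<..<r}))"

definition row_weight :: "(nat \<Rightarrow> nat) \<Rightarrow> nat \<Rightarrow> nat set \<Rightarrow> nat \<Rightarrow> qfield poly" where
  "row_weight lam t C r = monom (q ^ row_stat lam t C r) (if r \<le> lam t then 1 else 0)"

text \<open>Both sides are written in terms of \<open>P i\<close> and \<open>X * P i\<close> with
  coefficients in \<open>R i\<close>. On the right, columns outside the top row yield the multiples
  of \<open>P i\<close> and columns inside it the multiples of \<open>X * P i\<close>. On the left,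
  the recursion for \<open>rook_rec\<close> produces \<open>P i\<close> and
  \<open>P (Suc i)\<close>, and the latter is expanded.\<close>

lemma hit_formula_Suc:
  assumes "antimono lam" "finite C" "Suc d \<le> card C"
  shows "hit_formula lam (Suc d) s C =
    (\<Sum>r\<in>C. row_weight lam (Suc s) C r * hit_formula lam d (Suc s) (C - {r}))"
proof -
  define l where "l = lam (Suc s)"
  define a where "a = int (card (C \<inter> {..l}))"
  define b where "b = int (board_size lam d (Suc s) C)"
  define R where "R = rook_rec lam d (Suc s) C"
  define P :: "nat \<Rightarrow> qfield poly" where "P = qpochhammer [:0, 1:] [:q:]"
  define X :: "qfield poly" where "X = [:0, 1:]"
  obtain m where m: "card C = Suc m" "d \<le> m"
    using assms(3) by (cases "card C") auto
  \<comment> \<open>\<open>e\<close> and \<open>E\<close> collect the factors independent of the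
    rook numbers, for the smaller and the larger board. They share a denominator, as columns minus
    rows is \<open>m - d\<close> in both cases.\<close>
  define e where "e i = qfact (m - i) * (- 1) ^ i * q powi (int m * int i - int (i choose 2))
    / qfact (m - d)" for i
  define E where "E i = qfact (Suc m - i) * (- 1) ^ i * q powi (int (Suc m) * int i - int (i choose 2))
    / qfact (m - d)" for i
  define k where "k = card (C \<inter> {l<..})"
  have card_split: "card C = card (C \<inter> {..l}) + k"
    unfolding k_def using assms(2)
    by (subst card_Un_disjoint[symmetric]) (auto intro!: arg_cong[where f = card])
  have lam': "lam (Suc (Suc s)) \<le> l"
    unfolding l_def using assms(1) by (simp add: antimonoD)
  have formula_r: "hit_formula lam d (Suc s) (C - {r}) =
      (\<Sum>i\<le>d. smult (q powi (- int (board_size lam d (Suc s) (C - {r})))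
        * rook_rec lam d (Suc s) (C - {r}) i * e i) (P i))" if "r \<in> C" for r
    using that m assms(2)
    by (simp add: hit_formula_def e_def P_def smult_sum_right mult_ac)
  \<comment> \<open>Here the weight is free of \<open>x\<close> and the remaining board looks the
    same for every \<open>r\<close>, so the sum over \<open>r\<close> is geometric.\<close>
  have "(\<Sum>r\<in>C \<inter> {l<..}. row_weight lam (Suc s) C r * hit_formula lam d (Suc s) (C - {r})) =
      (\<Sum>r\<in>C \<inter> {l<..}. \<Sum>i\<le>d. smult (q ^ card (C \<inter> {l<..<r})) (smult (q powi (- b) * R i * e i) (P i)))"
  proof (rule sum.cong[OF refl])
    fix r assume r: "r \<in> C \<inter> {l<..}"
    then have *: "board_size lam d (Suc s) (C - {r}) = board_size lam d (Suc s) C"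
        "rook_rec lam d (Suc s) (C - {r}) i = rook_rec lam d (Suc s) C i" for i
      using remove_outer_column[OF assms(1), of "Suc s" r] lam' by auto
    have "row_weight lam (Suc s) C r = [:q ^ card (C \<inter> {l<..<r}):]"
      using r by (simp add: row_weight_def row_stat_def l_def monom_0)
    then show "row_weight lam (Suc s) C r * hit_formula lam d (Suc s) (C - {r}) =
        (\<Sum>i\<le>d. smult (q ^ card (C \<inter> {l<..<r})) (smult (q powi (- b) * R i * e i) (P i)))"
      using r formula_r[of r] by (simp add: * b_def R_def smult_sum_right)
  qed
  also have "\<dots> = (\<Sum>i\<le>d. smult (\<Sum>r\<in>C \<inter> {l<..}. q ^ card (C \<inter> {l<..<r}))
      (smult (q powi (- b) * R i * e i) (P i)))"
    by (subst sum.swap) (simp only: smult_sum)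
  also have "(\<Sum>r\<in>C \<inter> {l<..}. q ^ card (C \<inter> {l<..<r})) =
      (\<Sum>r\<in>C \<inter> {l<..}. q ^ card ((C \<inter> {l<..}) \<inter> {..<r}))"
    by (intro sum.cong refl arg_cong[where f = "\<lambda>A. q ^ card A"]) auto
  also have "\<dots> = qint (int k)"
    using sum_q_power_card_less assms(2) by (simp add: k_def)
  finally have outer: "(\<Sum>r\<in>C \<inter> {l<..}. row_weight lam (Suc s) C r * hit_formula lam d (Suc s) (C - {r})) =
      (\<Sum>i\<le>d. smult (qint (int k) * (q powi (- b) * R i * e i)) (P i))"
    by simp
  \<comment> \<open>Here the weight is \<open>x\<close> times \<open>q ^ k\<close> times a power
    counting the columns before \<open>r\<close>, which is the weight that
    \<open>rook_rec_remove_column_sum\<close> evaluates.\<close>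
  have "(\<Sum>r\<in>C \<inter> {..l}. row_weight lam (Suc s) C r * hit_formula lam d (Suc s) (C - {r})) =
      (\<Sum>r\<in>C \<inter> {..l}. \<Sum>i\<le>d. smult (q powi (int (card (C \<inter> {..<r})) - int (board_size lam d (Suc s) (C - {r})))
             * rook_rec lam d (Suc s) (C - {r}) i) (smult (q ^ k * e i) (X * P i)))"
  proof (rule sum.cong[OF refl])
    fix r assume r: "r \<in> C \<inter> {..l}"
    have "row_weight lam (Suc s) C r = smult (q ^ card (C \<inter> {..<r}) * q ^ k) X"
      using r by (simp add: row_weight_def row_stat_def l_def monom_altdef X_def k_def power_add)
    then show "row_weight lam (Suc s) C r * hit_formula lam d (Suc s) (C - {r}) =
        (\<Sum>i\<le>d. smult (q powi (int (card (C \<inter> {..<r})) - int (board_size lam d (Suc s) (C - {r})))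
             * rook_rec lam d (Suc s) (C - {r}) i) (smult (q ^ k * e i) (X * P i)))"
      using r formula_r[of r]
      by (simp add: smult_sum_right sum_distrib_left power_int_diff power_int_minus field_simps)
  qed
  also have "\<dots> = (\<Sum>i\<le>d. smult (q powi (int i - b) * qint (a - int i) * R i)
      (smult (q ^ k * e i) (X * P i)))"
    using rook_rec_remove_column_sum[OF assms(1,2) lam', of d]
    by (subst sum.swap) (simp only: smult_sum[symmetric] a_def b_def R_def)
  finally have inner: "(\<Sum>r\<in>C \<inter> {..l}. row_weight lam (Suc s) C r * hit_formula lam d (Suc s) (C - {r})) =
      (\<Sum>i\<le>d. smult (q powi (int i - b) * qint (a - int i) * R i * (q ^ k * e i)) (X * P i))"
    by simp
  have "hit_formula lam (Suc d) s C =
      (\<Sum>i\<le>Suc d. smult (q powi (- a - b) * rook_rec lam (Suc d) s C i * E i) (P i))"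
    unfolding hit_formula_def smult_sum_right smult_smult
    using m by (intro sum.cong refl) (simp add: E_def P_def a_def b_def l_def mult_ac del: rook_rec.simps)
  \<comment> \<open>The two terms of the recursion for \<open>rook_rec\<close> are separated.
    Shifting the index in the second sum then puts \<open>R i\<close> in both, next to
    \<open>P i\<close> and \<open>P (Suc i)\<close>.\<close>
  also have "\<dots> = (\<Sum>i\<le>Suc d. smult (q powi (- b - int i) * R i * E i) (P i)) +
      (\<Sum>i\<le>Suc d. smult (case i of 0 \<Rightarrow> 0 | Suc i' \<Rightarrow>
         q powi (- a - b) * qint (a - int i') * R i' * E i) (P i))"
    unfolding sum.distrib[symmetric]
  proof (rule sum.cong[OF refl])
    fix i
    show "smult (q powi (- a - b) * rook_rec lam (Suc d) s C i * E i) (P i) =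
      smult (q powi (- b - int i) * R i * E i) (P i) + smult (case i of 0 \<Rightarrow> 0 | Suc i' \<Rightarrow>
         q powi (- a - b) * qint (a - int i') * R i' * E i) (P i)"
      unfolding smult_add_left[symmetric]
      by (rule arg_cong[where f = "\<lambda>c. smult c (P i)"])
        (simp add: R_def[symmetric] l_def[symmetric] a_def[symmetric] power_int_diff power_int_minus
          field_simps split: nat.split)
  qed
  also have "(\<Sum>i\<le>Suc d. smult (q powi (- b - int i) * R i * E i) (P i)) =
      (\<Sum>i\<le>d. smult (q powi (- b - int i) * R i * E i) (P i))"
    by (simp add: R_def rook_rec_eq_0)
  also have "(\<Sum>i\<le>Suc d. smult (case i of 0 \<Rightarrow> 0 | Suc i' \<Rightarrow>
         q powi (- a - b) * qint (a - int i') * R i' * E i) (P i)) =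
      (\<Sum>i\<le>d. smult (q powi (- a - b) * qint (a - int i) * R i * E (Suc i)) (P (Suc i)))"
    by (subst sum.atMost_Suc_shift) simp
  also have "(\<Sum>i\<le>d. smult (q powi (- b - int i) * R i * E i) (P i)) + \<dots> =
      (\<Sum>i\<le>d. smult (qint (int k) * (q powi (- b) * R i * e i)) (P i)) +
      (\<Sum>i\<le>d. smult (q powi (int i - b) * qint (a - int i) * R i * (q ^ k * e i)) (X * P i))"
    unfolding sum.distrib[symmetric]
  proof (rule sum.cong[OF refl])
    fix i assume "i \<in> {..d}"
    then have i: "i \<le> m" using m by simp
    \<comment> \<open>The last factor of \<open>P (Suc i)\<close> is
      \<open>1 - x * q ^ i\<close>.\<close>
    have P_Suc: "P (Suc i) = P i - smult (q ^ i) (X * P i)"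
      by (simp add: P_def qpochhammer_def X_def poly_const_pow algebra_simps)
    have E: "E i = qint (int (Suc m) - int i) * q ^ i * e i"
      using i by (simp add: E_def e_def Suc_diff_le qfact_Suc algebra_simps power_int_add power_int_diff
          of_nat_diff)
    have "Suc i choose 2 = i + (i choose 2)"
      by (simp add: numeral_2_eq_2)
    then have E_Suc: "E (Suc i) = - (q powi (int (Suc m)) * e i)"
      using i by (simp add: E_def e_def algebra_simps power_int_add power_int_diff)
    have am: "int (Suc m) = a + int k"
      using m card_split by (simp add: a_def)
    \<comment> \<open>The summand \<open>q ^ k * qint (a - i)\<close> is the one that cancels
      against \<open>v\<close> in the coefficient of \<open>P i\<close>; what survives is
      \<open>qint k\<close>, the contribution of the outer columns.\<close>
    have qi: "qint (int (Suc m) - int i) = qint (int k) + q ^ k * qint (a - int i)"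
      using qint_add[of "int k" "a - int i"] am by (simp add: algebra_simps)
    define v where "v = q powi (- a - b) * qint (a - int i) * R i * E (Suc i)"
    have v: "v = - (q powi (- b) * q ^ k * qint (a - int i) * R i * e i)"
      unfolding v_def E_Suc am by (simp add: power_int_add power_int_diff power_int_minus field_simps)
    have 1: "q powi (- b - int i) * R i * E i + v = qint (int k) * (q powi (- b) * R i * e i)"
      unfolding v E qi by (simp add: power_int_diff power_int_minus field_simps)
    have 2: "- (v * q ^ i) = q powi (int i - b) * qint (a - int i) * R i * (q ^ k * e i)"
      unfolding v by (simp add: power_int_diff power_int_minus field_simps)
    show "smult (q powi (- b - int i) * R i * E i) (P i) +
        smult (q powi (- a - b) * qint (a - int i) * R i * E (Suc i)) (P (Suc i)) =
        smult (qint (int k) * (q powi (- b) * R i * e i)) (P i) +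
        smult (q powi (int i - b) * qint (a - int i) * R i * (q ^ k * e i)) (X * P i)"
      unfolding v_def[symmetric] P_Suc 1[symmetric] 2[symmetric]
      by (simp add: smult_diff_right smult_add_left)
  qed
  also have "\<dots> = (\<Sum>r\<in>C. row_weight lam (Suc s) C r * hit_formula lam d (Suc s) (C - {r}))"
    unfolding inner[symmetric] outer[symmetric]
    using assms(2)
    by (subst sum.union_disjoint[symmetric]) (auto intro!: sum.cong)
  finally show ?thesis .
qed

section \<open>Placements sorted by the rook in one row\<close>

lemma finite_placements: "finite B \<Longrightarrow> finite (placements B k)"
  by (rule finite_subset[of _ "Pow B"]) (auto simp: placements_def)

lemma placements_0: "placements B 0 = {{}}"
  by (auto simp: placements_def nonattacking_def)

lemma nonattacking_insert:
  assumes "t \<notin> fst ` p"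
  shows "nonattacking (insert (t, r) p) \<longleftrightarrow> nonattacking p \<and> r \<notin> snd ` p"
  using assms unfolding nonattacking_def by (auto simp: image_iff; metis fst_conv snd_conv)

lemma nonattacking_inj_on:
  assumes "nonattacking p"
  shows "inj_on fst p" "inj_on snd p"
  using assms by (auto simp: nonattacking_def inj_on_def)

text \<open>A placement either leaves row \<open>t\<close> empty or arises uniquely from a placement
  with one rook less on \<open>B\<close> by adding a rook in an unoccupied column. Both the rook
  numbers and the hit sums are decomposed this way.\<close>

lemma sum_placements_row:
  fixes f :: "cell set \<Rightarrow> 'a :: comm_monoid_add"
  assumes "finite A" "finite B" "\<And>c. c \<in> B \<Longrightarrow> fst c \<noteq> t"
  shows "sum f (placements ({t} \<times> A \<union> B) (Suc k)) =
    sum f (placements B (Suc k)) + (\<Sum>p\<in>placements B k. \<Sum>r\<in>A - snd ` p. f (insert (t, r) p))"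
proof -
  define U where "U = placements ({t} \<times> A \<union> B) (Suc k)"
  define S where "S = (SIGMA p:placements B k. A - snd ` p)"
  have fin: "finite U"
    using assms by (simp add: U_def finite_placements)
  have notin: "t \<notin> fst ` p" if "p \<in> placements B j" for p j
    using that assms(3) by (auto simp: placements_def)
  have "{p \<in> U. t \<notin> fst ` p} = placements B (Suc k)"
  proof (intro equalityI subsetI)
    fix p assume "p \<in> placements B (Suc k)"
    then show "p \<in> {p \<in> U. t \<notin> fst ` p}"
      using notin by (auto simp: U_def placements_def)
  qed (force simp: U_def placements_def)
  moreover have "{p \<in> U. t \<in> fst ` p} = (\<lambda>(p, r). insert (t, r) p) ` S"
  proof (intro equalityI subsetI)
    fix p assume p: "p \<in> {p \<in> U. t \<in> fst ` p}"
    then obtain r where r: "(t, r) \<in> p" by force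
    define p' where "p' = p - {(t, r)}"
    have ins: "p = insert (t, r) p'" and "(t, r) \<notin> p'"
      using r by (auto simp: p'_def)
    have na: "nonattacking p" and sub: "p \<subseteq> {t} \<times> A \<union> B" and "finite p" "card p = Suc k"
      using p by (auto simp: U_def placements_def)
    have t: "t \<notin> fst ` p'"
    proof
      assume "t \<in> fst ` p'"
      then obtain c where "c \<in> p" "c \<noteq> (t, r)" "fst c = t"
        by (auto simp: p'_def)
      then show False
        using na r unfolding nonattacking_def by fastforce
    qed
    have "r \<in> A" "p' \<subseteq> B"
      using sub r t assms(3) by (auto simp: p'_def image_iff; force)+
    moreover have "card p' = k" "finite p'"
      using \<open>finite p\<close> \<open>card p = Suc k\<close> r by (auto simp: p'_def)
    moreover have "nonattacking p'" "r \<notin> snd ` p'"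
      using na nonattacking_insert[OF t, of r] ins by auto
    ultimately have "(p', r) \<in> S"
      by (auto simp: S_def placements_def)
    then show "p \<in> (\<lambda>(p, r). insert (t, r) p) ` S"
      using ins by force
  next
    fix x assume "x \<in> (\<lambda>(p, r). insert (t, r) p) ` S"
    then obtain p r where x: "x = insert (t, r) p" and p: "p \<in> placements B k" "r \<in> A" "r \<notin> snd ` p"
      by (auto simp: S_def)
    have "(t, r) \<notin> p"
      using notin[OF p(1)] by force
    then show "x \<in> {p \<in> U. t \<in> fst ` p}"
      using p nonattacking_insert[OF notin[OF p(1)], of r]
      by (auto simp: x U_def placements_def)
  qed
  moreover have "inj_on (\<lambda>(p, r). insert (t, r) p) S"
  proof (rule inj_onI, clarify)
    fix p r p' r' assume *: "(p, r) \<in> S" "(p', r') \<in> S" "insert (t, r) p = insert (t, r') p'"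
    have "t \<notin> fst ` p" "t \<notin> fst ` p'"
      using * notin by (auto simp: S_def)
    then have **: "(t, u) \<notin> p" "(t, u) \<notin> p'" for u
      by force+
    then have "r = r'"
      using *(3) by blast
    then show "p = p' \<and> r = r'"
      using *(3) ** by (metis insert_ident)
  qed
  moreover have "sum f U = sum f {p \<in> U. t \<notin> fst ` p} + sum f {p \<in> U. t \<in> fst ` p}"
    using fin by (subst sum.union_disjoint[symmetric]) (auto intro!: sum.cong)
  moreover have "(\<Sum>p\<in>placements B k. \<Sum>r\<in>A - snd ` p. f (insert (t, r) p)) =
      (\<Sum>(p, r)\<in>S. f (insert (t, r) p))"
    unfolding S_def using assms by (intro sum.Sigma) (auto simp: finite_placements)
  ultimately show ?thesis
    by (simp add: U_def[symmetric] sum.reindex case_prod_unfold)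
qed

section \<open>\<open>rook_rec\<close> as a sum over placements\<close>

definition row_board :: "(nat \<Rightarrow> nat) \<Rightarrow> nat \<Rightarrow> nat \<Rightarrow> nat set \<Rightarrow> cell set" where
  "row_board lam d s C = (SIGMA i:{s<..s + d}. C \<inter> {..lam i})"

text \<open>The cells counted by \<open>inv_stat\<close>, for any set of cells in place of a Ferrers
  board.\<close>

definition inv_cells :: "cell set \<Rightarrow> cell set \<Rightarrow> cell set" where
  "inv_cells B p = {(i, j). (i, j) \<in> B \<and> (i, j) \<notin> p \<and>
     \<not> (\<exists>j'. (i, j') \<in> p \<and> j < j') \<and> \<not> (\<exists>i'. (i', j) \<in> p \<and> i < i')}"

lemma finite_row_board [simp]: "finite C \<Longrightarrow> finite (row_board lam d s C)"
  by (simp add: row_board_def)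

lemma greaterThanAtMost_Suc: "{s<..s + Suc d} = insert (Suc s) {Suc s<..Suc s + d}"
  by auto

lemma row_board_Suc:
  "row_board lam (Suc d) s C = {Suc s} \<times> (C \<inter> {..lam (Suc s)}) \<union> row_board lam d (Suc s) C"
  unfolding row_board_def greaterThanAtMost_Suc by auto

lemma card_row_board: "finite C \<Longrightarrow> card (row_board lam d s C) = board_size lam d s C"
proof (induction d arbitrary: s)
  case 0
  then show ?case by (simp add: row_board_def)
next
  case (Suc d)
  have "({Suc s} \<times> (C \<inter> {..lam (Suc s)})) \<inter> row_board lam d (Suc s) C = {}"
    by (auto simp: row_board_def)
  then show ?case
    using Suc by (simp add: row_board_Suc card_Un_disjoint card_cartesian_product_singleton)
qed

lemma card_row_Un:
  assumes "finite A" "finite B" "\<And>c. c \<in> B \<Longrightarrow> t < fst c"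
  shows "card ({t :: nat} \<times> A \<union> B) = card A + card B"
proof -
  have "({t} \<times> A) \<inter> B = {}"
    using assms(3) by force
  then show ?thesis
    using assms by (simp add: card_Un_disjoint card_cartesian_product_singleton)
qed

text \<open>All rooks lie below row \<open>t\<close>, so a cell of that row is cancelled exactly
  when its column is occupied.\<close>

lemma card_inv_cells_row_free:
  assumes "finite A" "finite B" "\<And>i j. (i, j) \<in> B \<Longrightarrow> t < i" "p \<subseteq> B"
  shows "card (inv_cells ({t} \<times> A \<union> B) p) = card (A - snd ` p) + card (inv_cells B p)"
proof -
  have rows: "t < i" if "(i, j) \<in> p" for i j
    using assms(3,4) that by auto
  have "inv_cells ({t} \<times> A \<union> B) p = {t} \<times> (A - snd ` p) \<union> inv_cells B p"
  proof (rule set_eqI, clarify)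
    fix i j
    show "(i, j) \<in> inv_cells ({t} \<times> A \<union> B) p \<longleftrightarrow> (i, j) \<in> {t} \<times> (A - snd ` p) \<union> inv_cells B p"
    proof (cases "i = t")
      case True
      then have "(i, j) \<notin> B" "\<And>j'. (i, j') \<notin> p"
        using assms(3) rows by auto
      moreover have "(\<exists>i'. (i', j) \<in> p \<and> i < i') \<longleftrightarrow> j \<in> snd ` p"
        using rows True by (force simp: image_iff)
      ultimately show ?thesis
        using True unfolding inv_cells_def by auto
    qed (simp add: inv_cells_def)
  qed
  moreover have "finite (inv_cells B p)"
    by (rule finite_subset[OF _ assms(2)]) (auto simp: inv_cells_def)
  moreover have "t < fst c" if "c \<in> inv_cells B p" for c
    using that assms(3) by (auto simp: inv_cells_def)
  ultimately show ?thesis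
    using assms(1) by (simp add: card_row_Un)
qed

text \<open>The new rook cancels its own cell and those to its left. Lying above all of
  \<open>B\<close>, it cancels nothing there.\<close>

lemma card_inv_cells_row_rook:
  assumes "finite A" "finite B" "\<And>i j. (i, j) \<in> B \<Longrightarrow> t < i" "p \<subseteq> B" "r \<in> A - snd ` p"
  shows "card (inv_cells ({t} \<times> A \<union> B) (insert (t, r) p)) =
    card ((A - snd ` p) \<inter> {r<..}) + card (inv_cells B p)"
proof -
  have rows: "t < i" if "(i, j) \<in> p" for i j
    using assms(3,4) that by auto
  have "inv_cells ({t} \<times> A \<union> B) (insert (t, r) p) = {t} \<times> ((A - snd ` p) \<inter> {r<..}) \<union> inv_cells B p"
  proof (rule set_eqI, clarify)
    fix i j
    show "(i, j) \<in> inv_cells ({t} \<times> A \<union> B) (insert (t, r) p) \<longleftrightarrow>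
        (i, j) \<in> {t} \<times> ((A - snd ` p) \<inter> {r<..}) \<union> inv_cells B p"
    proof (cases "i = t")
      case True
      then have "(i, j) \<notin> B" "\<And>j'. (i, j') \<notin> p"
        using assms(3) rows by auto
      moreover have "(\<exists>i'. (i', j) \<in> insert (t, r) p \<and> i < i') \<longleftrightarrow> j \<in> snd ` p"
        using rows True by (force simp: image_iff)
      ultimately show ?thesis
        using True unfolding inv_cells_def by auto
    next
      case False
      have "(\<exists>i'. (i', j) \<in> insert (t, r) p \<and> i < i') \<longleftrightarrow> (\<exists>i'. (i', j) \<in> p \<and> i < i')"
        if "(i, j) \<in> B"
        using assms(3)[OF that] by auto
      then show ?thesis
        using False by (auto simp: inv_cells_def)
    qed
  qed
  moreover have "finite (inv_cells B p)"
    by (rule finite_subset[OF _ assms(2)]) (auto simp: inv_cells_def)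
  moreover have "t < fst c" if "c \<in> inv_cells B p" for c
    using that assms(3) by (auto simp: inv_cells_def)
  ultimately show ?thesis
    using assms(1) by (simp add: card_row_Un)
qed

text \<open>Placements without and with a rook in the top row give the two summands of
  \<open>rook_rec\<close>.\<close>

lemma rook_rec_eq_sum:
  assumes "antimono lam" "finite C"
  shows "rook_rec lam d s C k =
    (\<Sum>p\<in>placements (row_board lam d s C) k. q ^ card (inv_cells (row_board lam d s C) p))"
proof (induction d arbitrary: s k)
  case 0
  have B: "row_board lam 0 s C = {}"
    by (simp add: row_board_def)
  show ?case
  proof (cases k)
    case 0
    then show ?thesis by (simp add: B placements_0 inv_cells_def)
  next
    case (Suc k')
    then have "placements {} k = {}"
      by (auto simp: placements_def)
    then show ?thesis using Suc by (simp add: B)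
  qed
next
  case (Suc d)
  define A where "A = C \<inter> {..lam (Suc s)}"
  define B where "B = row_board lam d (Suc s) C"
  have B_Suc: "row_board lam (Suc d) s C = {Suc s} \<times> A \<union> B"
    by (simp add: row_board_Suc A_def B_def)
  have fin: "finite A" "finite B"
    using assms by (simp_all add: A_def B_def)
  have rows: "Suc s < i" if "(i, j) \<in> B" for i j
    using that by (auto simp: B_def row_board_def)
  \<comment> \<open>The top row is the longest, so every rook below it blocks one of its cells;
    hence the number of free cells depends only on the number of rooks.\<close>
  have cols: "j \<in> A" if "(i, j) \<in> B" for i j
    using that rows[OF that] antimonoD[OF assms(1), of "Suc s" i] by (auto simp: B_def A_def row_board_def)
  have card_free: "int (card (A - snd ` p)) = int (card A) - int k" if "p \<in> placements B k" for p k
  proof -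
    have "card (snd ` p) = k" "snd ` p \<subseteq> A"
      using that cols by (auto simp: placements_def card_image nonattacking_inj_on)
    then show ?thesis
      using fin card_mono[of A "snd ` p"] by (simp add: card_Diff_subset finite_subset of_nat_diff)
  qed
  have free: "q ^ card (inv_cells ({Suc s} \<times> A \<union> B) p) =
      q powi (int (card A) - int k) * q ^ card (inv_cells B p)" if "p \<in> placements B k" for p k
  proof -
    have "card (inv_cells ({Suc s} \<times> A \<union> B) p) = card (A - snd ` p) + card (inv_cells B p)"
      using that by (intro card_inv_cells_row_free fin rows) (auto simp: placements_def)
    then show ?thesis
      using card_free[OF that] by (simp add: power_add power_int_add flip: power_int_of_nat)
  qed
  \<comment> \<open>As the new rook moves through the free columns, the number of free columns to
    its right takes each value once.\<close>
  have rook: "(\<Sum>r\<in>A - snd ` p. q ^ card (inv_cells ({Suc s} \<times> A \<union> B) (insert (Suc s, r) p))) =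
      qint (int (card A) - int k) * q ^ card (inv_cells B p)" if "p \<in> placements B k" for p k
  proof -
    have "(\<Sum>r\<in>A - snd ` p. q ^ card (inv_cells ({Suc s} \<times> A \<union> B) (insert (Suc s, r) p))) =
        (\<Sum>r\<in>A - snd ` p. q ^ card ((A - snd ` p) \<inter> {r<..}) * q ^ card (inv_cells B p))"
      using that by (intro sum.cong refl)
        (subst card_inv_cells_row_rook[OF fin rows], auto simp: placements_def power_add)
    also have "\<dots> = qint (int (card (A - snd ` p))) * q ^ card (inv_cells B p)"
      using fin by (simp add: sum_distrib_right[symmetric] sum_q_power_card_greater)
    finally show ?thesis
      using card_free[OF that] by simp
  qed
  have IH: "rook_rec lam d (Suc s) C k = (\<Sum>p\<in>placements B k. q ^ card (inv_cells B p))" for k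
    by (simp add: Suc.IH B_def)
  show ?case
  proof (cases k)
    case 0
    have "{} \<in> placements B 0"
      by (simp add: placements_0)
    then show ?thesis
      using free[of "{}" 0] 0
      by (simp add: B_Suc IH placements_0 A_def[symmetric])
  next
    case (Suc k')
    have "(\<Sum>p\<in>placements ({Suc s} \<times> A \<union> B) k. q ^ card (inv_cells ({Suc s} \<times> A \<union> B) p)) =
        (\<Sum>p\<in>placements B k. q ^ card (inv_cells ({Suc s} \<times> A \<union> B) p)) +
        (\<Sum>p\<in>placements B k'. \<Sum>r\<in>A - snd ` p.
           q ^ card (inv_cells ({Suc s} \<times> A \<union> B) (insert (Suc s, r) p)))"
      unfolding Suc using fin by (intro sum_placements_row) (auto dest: rows)
    then show ?thesis
      by (simp add: B_Suc Suc IH A_def[symmetric] free rook sum_distrib_left)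
  qed
qed

section \<open>The same recursion for the sum over hit placements\<close>

text \<open>With \<open>B\<close> a full rectangular board, lying in the Ferrers board amounts to
  \<open>j \<le> lam i\<close>.\<close>

definition stat_cells :: "(nat \<Rightarrow> nat) \<Rightarrow> cell set \<Rightarrow> cell set \<Rightarrow> cell set" where
  "stat_cells lam B p = {(i, j). (i, j) \<in> B \<and> (i, j) \<notin> p \<and>
     \<not> (\<exists>i'. (i', j) \<in> p \<and> i' < i) \<and>
     (j \<le> lam i \<and> (\<exists>j'. (i, j') \<in> p \<and> j' \<le> lam i \<and> j < j') \<or>
      lam i < j \<and> (\<exists>j'. (i, j') \<in> p \<and> (j' \<le> lam i \<or> j < j')))}"

text \<open>All numbers of hits are treated at once: the exponent of \<open>x\<close> records the
  rooks on the Ferrers board.\<close>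

definition hit_sum :: "(nat \<Rightarrow> nat) \<Rightarrow> nat \<Rightarrow> nat \<Rightarrow> nat set \<Rightarrow> qfield poly" where
  "hit_sum lam d s C = (\<Sum>p\<in>placements ({s<..s + d} \<times> C) d.
     monom (q ^ card (stat_cells lam ({s<..s + d} \<times> C) p)) (card {c \<in> p. snd c \<le> lam (fst c)}))"

text \<open>The top rook rules out every cell below it, which is why column \<open>r\<close>
  disappears from the remaining board. Rooks below do not affect row \<open>t\<close>.\<close>

lemma card_stat_cells_row:
  assumes "finite C" "finite I" "\<And>i. i \<in> I \<Longrightarrow> t < i" "p \<subseteq> I \<times> (C - {r})" "r \<in> C"
  shows "card (stat_cells lam ({t} \<times> C \<union> I \<times> C) (insert (t, r) p)) =
    row_stat lam t C r + card (stat_cells lam (I \<times> (C - {r})) p)"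
proof -
  define D where "D = (if r \<le> lam t then (C \<inter> {..<r}) \<union> (C \<inter> {lam t<..}) else C \<inter> {lam t<..<r})"
  have rows: "t < i" "j \<noteq> r" if "(i, j) \<in> p" for i j
    using assms(3,4) that by auto
  have "stat_cells lam ({t} \<times> C \<union> I \<times> C) (insert (t, r) p) =
      {t} \<times> D \<union> stat_cells lam (I \<times> (C - {r})) p"
  proof (rule set_eqI, clarify)
    fix i j
    consider "i = t" | "i \<in> I" "t < i" | "i \<noteq> t" "i \<notin> I"
      using assms(3) by blast
    then show "(i, j) \<in> stat_cells lam ({t} \<times> C \<union> I \<times> C) (insert (t, r) p) \<longleftrightarrow>
        (i, j) \<in> {t} \<times> D \<union> stat_cells lam (I \<times> (C - {r})) p"
    proof cases
      case 1
      have "t \<notin> I" using assms(3) by blast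
      moreover have "(t, j') \<notin> p" for j' using rows(1) by blast
      moreover have "\<not> i' < t" if "(i', j) \<in> p" for i' using rows(1)[OF that] by simp
      ultimately show ?thesis
        unfolding 1 stat_cells_def D_def by auto
    next
      case 2
      then show ?thesis
        unfolding stat_cells_def by auto
    next
      case 3
      then show ?thesis
        unfolding stat_cells_def by auto
    qed
  qed
  moreover have "card D = row_stat lam t C r"
    unfolding D_def row_stat_def using assms(1) by (auto intro!: card_Un_disjoint)
  moreover have "finite D"
    using assms(1) by (simp add: D_def)
  moreover have "finite (stat_cells lam (I \<times> (C - {r})) p)"
    by (rule finite_subset[of _ "I \<times> (C - {r})"]) (auto simp: stat_cells_def assms)
  moreover have "t < fst c" if "c \<in> stat_cells lam (I \<times> (C - {r})) p" for c
    using that assms(3) by (auto simp: stat_cells_def)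
  ultimately show ?thesis
    by (simp add: card_row_Un)
qed

lemma hit_sum_Suc:
  assumes "finite C"
  shows "hit_sum lam (Suc d) s C =
    (\<Sum>r\<in>C. row_weight lam (Suc s) C r * hit_sum lam d (Suc s) (C - {r}))"
proof -
  define I where "I = {Suc s<..Suc s + d}"
  define t where "t = Suc s"
  have I: "finite I" "card I = d" "\<And>i. i \<in> I \<Longrightarrow> t < i"
    by (auto simp: I_def t_def)
  have rows: "{s<..s + Suc d} \<times> C = {t} \<times> C \<union> I \<times> C"
    unfolding I_def t_def greaterThanAtMost_Suc by auto
  define g where "g p = monom (q ^ card (stat_cells lam ({t} \<times> C \<union> I \<times> C) p))
     (card {c \<in> p. snd c \<le> lam (fst c)})" for p
  \<comment> \<open>There are more rooks than rows, so the placements that leave the top row empty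
    contribute nothing.\<close>
  have "placements (I \<times> C) (Suc d) = {}"
  proof -
    have False if "p \<in> placements (I \<times> C) (Suc d)" for p
    proof -
      have "card (fst ` p) = Suc d" "fst ` p \<subseteq> I"
        using that by (auto simp: placements_def card_image nonattacking_inj_on)
      then show False
        using I card_mono[of I "fst ` p"] by simp
    qed
    then show ?thesis by blast
  qed
  moreover have "fst c \<noteq> t" if "c \<in> I \<times> C" for c
    using that I(3) by force
  ultimately have "hit_sum lam (Suc d) s C = (\<Sum>p\<in>placements (I \<times> C) d. \<Sum>r\<in>C - snd ` p. g (insert (t, r) p))"
    using sum_placements_row[of C "I \<times> C" t g d] assms I
    unfolding hit_sum_def rows g_def[symmetric] by simp
  also have "\<dots> = (\<Sum>p\<in>placements (I \<times> C) d. \<Sum>r\<in>{r \<in> C. r \<notin> snd ` p}. g (insert (t, r) p))"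
    by (simp add: set_diff_eq)
  \<comment> \<open>Fixing the column of the top rook first turns the inner sum into one over
    placements that avoid this column.\<close>
  also have "\<dots> = (\<Sum>r\<in>C. \<Sum>p\<in>{p \<in> placements (I \<times> C) d. r \<notin> snd ` p}. g (insert (t, r) p))"
    using assms I by (intro sum.swap_restrict finite_placements) auto
  also have "\<dots> = (\<Sum>r\<in>C. row_weight lam t C r * hit_sum lam d t (C - {r}))"
  proof (rule sum.cong[OF refl])
    fix r assume r: "r \<in> C"
    have eq: "{p \<in> placements (I \<times> C) d. r \<notin> snd ` p} = placements (I \<times> (C - {r})) d"
      by (auto simp: placements_def; force)
    show "(\<Sum>p\<in>{p \<in> placements (I \<times> C) d. r \<notin> snd ` p}. g (insert (t, r) p)) =
        row_weight lam t C r * hit_sum lam d t (C - {r})"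
      unfolding eq hit_sum_def sum_distrib_left t_def[symmetric]
    proof (rule sum.cong)
      fix p assume p: "p \<in> placements ({t<..t + d} \<times> (C - {r})) d"
      then have sub: "p \<subseteq> I \<times> (C - {r})" "finite p"
        by (auto simp: placements_def I_def t_def)
      have "(t, r) \<notin> p"
        using sub by auto
      moreover have "{c \<in> insert (t, r) p. snd c \<le> lam (fst c)} =
          (if r \<le> lam t then insert (t, r) {c \<in> p. snd c \<le> lam (fst c)} else {c \<in> p. snd c \<le> lam (fst c)})"
        by auto
      ultimately have "card {c \<in> insert (t, r) p. snd c \<le> lam (fst c)} =
          (if r \<le> lam t then 1 else 0) + card {c \<in> p. snd c \<le> lam (fst c)}"
        using sub by simp
      moreover have "card (stat_cells lam ({t} \<times> C \<union> I \<times> C) (insert (t, r) p)) =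
          row_stat lam t C r + card (stat_cells lam (I \<times> (C - {r})) p)"
        by (rule card_stat_cells_row[OF assms I(1,3) sub(1) r])
      ultimately show "g (insert (t, r) p) = row_weight lam t C r *
          monom (q ^ card (stat_cells lam ({t<..t + d} \<times> (C - {r})) p)) (card {c \<in> p. snd c \<le> lam (fst c)})"
        by (simp add: g_def row_weight_def mult_monom power_add I_def[folded t_def])
    qed (simp add: I_def t_def)
  qed
  finally show ?thesis by (simp add: t_def)
qed

section \<open>Equality of the two sides and the return to partitions\<close>

text \<open>Without rows both sides equal 1. The recursion removes one row and one column together,
  so the bound on \<open>d\<close> is inherited.\<close>

lemma hit_sum_eq_hit_formula:
  assumes "antimono lam" "finite C" "d \<le> card C"
  shows "hit_sum lam d s C = hit_formula lam d s C"
  using assms(2,3)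
proof (induction d arbitrary: s C)
  case 0
  then show ?case
    by (simp add: hit_sum_def hit_formula_def placements_0 stat_cells_def qpochhammer_def monom_0 binomial_eq_0)
next
  case (Suc d)
  then show ?case
    unfolding hit_sum_Suc[OF Suc.prems(1)] hit_formula_Suc[OF assms(1) Suc.prems]
    by (intro sum.cong refl arg_cong2[where f = "(*)"] Suc.IH) auto
qed

theorem theorem2p9:
  fixes m n j :: nat and la :: "nat list"
  assumes "n \<le> m" and "is_partition la" and "inside_board la n m" and "j \<le> n"
  shows "qhit m n la j = (\<Sum>p\<in>hit_placements m n la j. q ^ stat m n la p)"
proof -
  \<comment> \<open>Rows below the partition get length 0. Truncated subtraction gives row 0 the
    length of row 1, so \<open>lam\<close> is antitone on all of the naturals and
    \<open>lam 0\<close> bounds it.\<close>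
  define lam where "lam i = (if i - 1 < length la then la ! (i - 1) else 0)" for i
  have "antimono lam"
  proof (rule antimonoI)
    fix x y :: nat
    assume "x \<le> y"
    then have "x - 1 \<le> y - 1" by simp
    moreover have "la ! j \<le> la ! i" if "i \<le> j" "j < length la" for i j
      using that assms(2) by (cases "i = j") (auto simp: is_partition_def sorted_wrt_iff_nth_less)
    ultimately show "lam y \<le> lam x"
      by (auto simp: lam_def)
  qed
  have lam_le: "lam i \<le> m" for i
  proof -
    have "lam i \<le> lam 0"
      using \<open>antimono lam\<close> by (simp add: antimonoD)
    also have "\<dots> \<le> m"
      using assms(3) by (cases la) (auto simp: lam_def inside_board_def)
    finally show ?thesis .
  qed
  have "(i, j) \<in> ferrers la \<longleftrightarrow> (i, j) \<in> row_board lam n 0 {1..m}" for i j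
  proof -
    have "i \<le> n" if "i \<le> length la"
      using that assms(3) by (simp add: inside_board_def)
    then show ?thesis
      using lam_le[of i] by (auto simp: ferrers_def row_board_def lam_def)
  qed
  then have ferrers: "ferrers la = row_board lam n 0 {1..m}"
    by (intro set_eqI) (simp add: split_paired_all)
  have "qrook la k = rook_rec lam n 0 {1..m} k" for k
    unfolding rook_rec_eq_sum[OF \<open>antimono lam\<close> finite_atLeastAtMost] qrook_def inv_stat_def ferrers inv_cells_def ..
  then have "qhit_poly m n la = hit_formula lam n 0 {1..m}"
    by (simp add: qhit_poly_def hit_formula_def ferrers card_row_board)
  also have "\<dots> = hit_sum lam n 0 {1..m}"
    using assms(1) \<open>antimono lam\<close> by (simp add: hit_sum_eq_hit_formula)
  also have "\<dots> = (\<Sum>p\<in>placements (board n m) n. monom (q ^ stat m n la p) (card (p \<inter> ferrers la)))"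
  proof -
    have board: "{0<..0 + n} \<times> {1..m} = board n m"
      by (auto simp: board_def)
    have mem: "(i, j) \<in> ferrers la \<longleftrightarrow> j \<le> lam i" if "(i, j) \<in> board n m" for i j
      using that by (auto simp: ferrers row_board_def board_def)
    show ?thesis
      unfolding hit_sum_def board
    proof (intro sum.cong refl arg_cong2[where f = monom] arg_cong2[where f = power])
      fix p assume "p \<in> placements (board n m) n"
      then have p: "c \<in> board n m" if "c \<in> p" for c
        using that by (auto simp: placements_def)
      show "card {c \<in> p. snd c \<le> lam (fst c)} = card (p \<inter> ferrers la)"
        using p mem by (intro arg_cong[where f = card]) auto
      show "card (stat_cells lam (board n m) p) = stat m n la p"
        unfolding stat_cells_def stat_def
        using p mem by (intro arg_cong[where f = card] Collect_cong) (auto simp: not_le; meson not_le)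
    qed
  qed
  \<comment> \<open>Taking the coefficient of \<open>x ^ j\<close> selects the placements with
    exactly \<open>j\<close> hits.\<close>
  finally have "qhit m n la j =
      (\<Sum>p\<in>placements (board n m) n. if card (p \<inter> ferrers la) = j then q ^ stat m n la p else 0)"
    by (simp add: qhit_def coeff_sum)
  also have "\<dots> = (\<Sum>p\<in>hit_placements m n la j. q ^ stat m n la p)"
    unfolding hit_placements_def
    by (subst sum.inter_filter) (auto simp: finite_placements board_def)
  finally show ?thesis .
qed

end
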